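(* Let $n\ge1$ and let $M_n(\mathbf C)$ be endowed with the coproduct $\Delta:M_n(\mathbf C)\to M_n(\mathbf C)\otimes M_n(\mathbf C)$ given on the matrix units by $\Delta(E_{ij})=E_{ij}\otimes E_{ij}$ and extended by linearity. Then there exist no nonzero coderivations of the coalgebra $M_n(\mathbf C)$. Consequently, there are no nonzero vertical coderivations of $\mathcal S'(\mathbf R^n)\otimes M_n(\mathbf C)$, i.e. no nonzero operators of the form $\tilde Y^*=\mathrm{id}\otimes Y^*$ with $Y^*$ a coderivation of the coalgebra $M_n(\mathbf C)$.
   Context: A coderivation of a coalgebra $(C,\Delta)$ is a linear map $Y^*:C\to C$ satisfying the co-Leibniz rule $\Delta\circ Y^*=(Y^*\otimes\mathrm{id}_C)\circ\Delta+(\mathrm{id}_C\otimes Y^* )\circ\Delta$. $\mathcal S'(\mathbf R^n)$ is the space of tempered distributions on $\mathbf R^n$. *)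

theory Defs
  imports "HOL-Analysis.Analysis" "HOL-Library.Poly_Mapping"
begin

section \<open>Complex vector spaces\<close>

class complex_vector = ab_group_add +
  fixes scaleC :: "complex \<Rightarrow> 'a \<Rightarrow> 'a"  (infixr \<open>*\<^sub>C\<close> 75)
  assumes scaleC_add_right: "a *\<^sub>C (x + y) = a *\<^sub>C x + a *\<^sub>C y"
    and scaleC_add_left: "(a + b) *\<^sub>C x = a *\<^sub>C x + b *\<^sub>C x"
    and scaleC_scaleC: "a *\<^sub>C (b *\<^sub>C x) = (a * b) *\<^sub>C x"
    and scaleC_one: "1 *\<^sub>C x = x"

interpretation complex_vector:
  vector_space "scaleC :: complex \<Rightarrow> 'a \<Rightarrow> 'a::complex_vector"
  by unfold_locales (simp_all add: scaleC_add_right scaleC_add_left scaleC_scaleC scaleC_one)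

abbreviation clinear :: "('a::complex_vector \<Rightarrow> 'b::complex_vector) \<Rightarrow> bool"
  where "clinear \<equiv> Vector_Spaces.linear scaleC scaleC"

lemma clinear_iff:
  "clinear f \<longleftrightarrow> (\<forall>x y. f (x + y) = f x + f y) \<and> (\<forall>c x. f (c *\<^sub>C x) = c *\<^sub>C f x)"
  by (simp add: Vector_Spaces.linear_iff complex_vector.vector_space_axioms)

definition cbilinear :: "('a::complex_vector \<Rightarrow> 'b::complex_vector \<Rightarrow> 'c::complex_vector) \<Rightarrow> bool"
  where "cbilinear b \<longleftrightarrow> (\<forall>x. clinear (\<lambda>y. b x y)) \<and> (\<forall>y. clinear (\<lambda>x. b x y))"

instantiation complex :: complex_vector
begin
definition scaleC_complex :: "complex \<Rightarrow> complex \<Rightarrow> complex"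
  where "scaleC_complex c z = c * z"
instance by standard (simp_all add: scaleC_complex_def algebra_simps)
end

instantiation vec :: (complex_vector, finite) complex_vector
begin
definition scaleC_vec :: "complex \<Rightarrow> 'a ^ 'b \<Rightarrow> 'a ^ 'b"
  where "scaleC_vec c v = (\<chi> i. c *\<^sub>C (v $ i))"
instance
  by standard
    (simp_all add: scaleC_vec_def vec_eq_iff scaleC_add_right scaleC_add_left scaleC_scaleC scaleC_one)
end

instantiation poly_mapping :: (type, complex_vector) complex_vector
begin
lift_definition scaleC_poly_mapping :: "complex \<Rightarrow> ('a \<Rightarrow>\<^sub>0 'b) \<Rightarrow> 'a \<Rightarrow>\<^sub>0 'b"
  is "\<lambda>c f k. c *\<^sub>C f k"
  by (rule finite_subset[rotated]) auto
instance
  by standard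
    (transfer; simp add: fun_eq_iff scaleC_add_right scaleC_add_left scaleC_scaleC scaleC_one)+
end


section \<open>The algebraic tensor product\<close>

text \<open>
  The tensor product is the free complex vector space on pairs, that is, the finitely supported
  functions \<^typ>\<open>'a \<times> 'b \<Rightarrow>\<^sub>0 complex\<close>, modulo the subspace spanned by the bilinearity relations.
\<close>

abbreviation free_pair :: "'a \<Rightarrow> 'b \<Rightarrow> ('a \<times> 'b) \<Rightarrow>\<^sub>0 complex"
  where "free_pair x y \<equiv> Poly_Mapping.single (x, y) 1"

definition bilinearity_relations :: "(('a::complex_vector \<times> 'b::complex_vector) \<Rightarrow>\<^sub>0 complex) set"
  where "bilinearity_relations =
    {free_pair (x + x') y - free_pair x y - free_pair x' y | x x' y. True} \<union>
    {free_pair x (y + y') - free_pair x y - free_pair x y' | x y y'. True} \<union>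
    {free_pair (c *\<^sub>C x) y - c *\<^sub>C free_pair x y | c x y. True} \<union>
    {free_pair x (c *\<^sub>C y) - c *\<^sub>C free_pair x y | c x y. True}"

definition tensor_equiv ::
    "(('a::complex_vector \<times> 'b::complex_vector) \<Rightarrow>\<^sub>0 complex) \<Rightarrow> ('a \<times> 'b \<Rightarrow>\<^sub>0 complex) \<Rightarrow> bool"
  where "tensor_equiv p q \<longleftrightarrow> p - q \<in> complex_vector.span bilinearity_relations"

lemma equivp_tensor_equiv: "equivp tensor_equiv"
proof (rule equivpI)
  show "reflp tensor_equiv"
    by (simp add: reflp_def tensor_equiv_def complex_vector.span_zero)
  show "symp tensor_equiv"
    unfolding symp_def tensor_equiv_def by (metis complex_vector.span_neg minus_diff_eq)
  show "transp tensor_equiv"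
    unfolding transp_def tensor_equiv_def
    by (metis (no_types, lifting) complex_vector.span_add diff_add_cancel add_diff_eq)
qed

quotient_type (overloaded) ('a, 'b) tensor (infixl \<open>\<otimes>\<close> 70) =
  "('a::complex_vector \<times> 'b::complex_vector) \<Rightarrow>\<^sub>0 complex" / tensor_equiv
  by (rule equivp_tensor_equiv)

instantiation tensor :: (complex_vector, complex_vector) complex_vector
begin

lift_definition zero_tensor :: "'a \<otimes> 'b" is 0 .

lift_definition plus_tensor :: "'a \<otimes> 'b \<Rightarrow> 'a \<otimes> 'b \<Rightarrow> 'a \<otimes> 'b" is plus
  unfolding tensor_equiv_def add_diff_add by (rule complex_vector.span_add)

lift_definition uminus_tensor :: "'a \<otimes> 'b \<Rightarrow> 'a \<otimes> 'b" is uminus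
  unfolding tensor_equiv_def minus_diff_minus by (rule complex_vector.span_neg)

lift_definition minus_tensor :: "'a \<otimes> 'b \<Rightarrow> 'a \<otimes> 'b \<Rightarrow> 'a \<otimes> 'b" is minus
proof -
  fix p p' q q' :: "('a \<times> 'b) \<Rightarrow>\<^sub>0 complex"
  assume "tensor_equiv p p'" "tensor_equiv q q'"
  moreover have "(p - q) - (p' - q') = (p - p') - (q - q')" by (simp add: algebra_simps)
  ultimately show "tensor_equiv (p - q) (p' - q')"
    unfolding tensor_equiv_def by (simp only: complex_vector.span_diff)
qed

lift_definition scaleC_tensor :: "complex \<Rightarrow> 'a \<otimes> 'b \<Rightarrow> 'a \<otimes> 'b" is scaleC
  unfolding tensor_equiv_def complex_vector.scale_right_diff_distrib[symmetric]
  by (rule complex_vector.span_scale)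

instance
proof
  fix a b :: complex and x y z :: "'a \<otimes> 'b"
  have eq: "p = q \<Longrightarrow> tensor_equiv p q" for p q :: "('a \<times> 'b) \<Rightarrow>\<^sub>0 complex"
    by (simp add: tensor_equiv_def complex_vector.span_zero)
  show "x + y + z = x + (y + z)" by transfer (rule eq, simp add: add.assoc)
  show "x + y = y + x" by transfer (rule eq, simp add: add.commute)
  show "0 + x = x" by transfer (rule eq, simp)
  show "- x + x = 0" by transfer (rule eq, simp)
  show "x - y = x + - y" by transfer (rule eq, simp)
  show "a *\<^sub>C (x + y) = a *\<^sub>C x + a *\<^sub>C y" by transfer (rule eq, simp add: scaleC_add_right)
  show "(a + b) *\<^sub>C x = a *\<^sub>C x + b *\<^sub>C x" by transfer (rule eq, simp add: scaleC_add_left)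
  show "a *\<^sub>C (b *\<^sub>C x) = (a * b) *\<^sub>C x" by transfer (rule eq, simp add: scaleC_scaleC)
  show "1 *\<^sub>C x = x" by transfer (rule eq, simp add: scaleC_one)
qed

end

lift_definition tensor_of :: "'a::complex_vector \<Rightarrow> 'b::complex_vector \<Rightarrow> 'a \<otimes> 'b"
    (infixl \<open>\<otimes>\<^sub>t\<close> 70)
  is free_pair .

lemma cbilinear_tensor_of: "cbilinear (\<otimes>\<^sub>t)"
proof -
  have *: "p - q \<in> bilinearity_relations \<Longrightarrow> tensor_equiv p q"
    for p q :: "('a \<times> 'b) \<Rightarrow>\<^sub>0 complex"
    by (simp add: tensor_equiv_def complex_vector.span_base)
  have "(x + x') \<otimes>\<^sub>t y = x \<otimes>\<^sub>t y + x' \<otimes>\<^sub>t y" for x x' :: 'a and y :: 'b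
    by transfer (rule *, unfold bilinearity_relations_def diff_diff_eq[symmetric], blast)
  moreover have "x \<otimes>\<^sub>t (y + y') = x \<otimes>\<^sub>t y + x \<otimes>\<^sub>t y'" for x :: 'a and y y' :: 'b
    by transfer (rule *, unfold bilinearity_relations_def diff_diff_eq[symmetric], blast)
  moreover have "(c *\<^sub>C x) \<otimes>\<^sub>t y = c *\<^sub>C (x \<otimes>\<^sub>t y)" for c and x :: 'a and y :: 'b
    by transfer (rule *, unfold bilinearity_relations_def, blast)
  moreover have "x \<otimes>\<^sub>t (c *\<^sub>C y) = c *\<^sub>C (x \<otimes>\<^sub>t y)" for c and x :: 'a and y :: 'b
    by transfer (rule *, unfold bilinearity_relations_def, blast)
  ultimately show ?thesis
    unfolding cbilinear_def clinear_iff by blast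
qed

lemma poly_mapping_eq_sum_single:
  fixes p :: "'k \<Rightarrow>\<^sub>0 complex"
  shows "p = (\<Sum>k\<in>Poly_Mapping.keys p. Poly_Mapping.lookup p k *\<^sub>C Poly_Mapping.single k 1)"
proof (rule poly_mapping_eqI)
  fix k
  have "(\<Sum>i\<in>Poly_Mapping.keys p.
           Poly_Mapping.lookup (Poly_Mapping.lookup p i *\<^sub>C Poly_Mapping.single i 1) k) =
        (\<Sum>i\<in>Poly_Mapping.keys p. if i = k then Poly_Mapping.lookup p k else 0)"
    by (intro sum.cong refl)
      (auto simp: scaleC_poly_mapping.rep_eq lookup_single scaleC_complex_def when_def)
  also have "\<dots> = Poly_Mapping.lookup p k"
    by (simp add: sum.delta in_keys_iff)
  finally show "Poly_Mapping.lookup p k = Poly_Mapping.lookup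
      (\<Sum>k\<in>Poly_Mapping.keys p. Poly_Mapping.lookup p k *\<^sub>C Poly_Mapping.single k 1) k"
    by (simp add: lookup_sum)
qed

lemma abs_tensor_sum: "abs_tensor (\<Sum>k\<in>K. f k) = (\<Sum>k\<in>K. abs_tensor (f k))"
  by (induction K rule: infinite_finite_induct)
    (simp_all add: zero_tensor.abs_eq[symmetric] plus_tensor.abs_eq[symmetric])

lemma tensor_eq_sum_tensor_of:
  fixes t :: "'a::complex_vector \<otimes> 'b::complex_vector"
  shows "\<exists>K c. finite K \<and> t = (\<Sum>(x, y)\<in>K. c (x, y) *\<^sub>C (x \<otimes>\<^sub>t y))"
proof -
  obtain p where t: "t = abs_tensor p" by (metis Quotient3_abs_rep Quotient3_tensor)
  have "t = abs_tensor
      (\<Sum>k\<in>Poly_Mapping.keys p. Poly_Mapping.lookup p k *\<^sub>C Poly_Mapping.single k 1)"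
    unfolding t by (rule arg_cong[where f = abs_tensor]) (rule poly_mapping_eq_sum_single)
  also have "\<dots> = (\<Sum>(x, y)\<in>Poly_Mapping.keys p. Poly_Mapping.lookup p (x, y) *\<^sub>C (x \<otimes>\<^sub>t y))"
    unfolding abs_tensor_sum
    by (intro sum.cong refl) (auto simp: scaleC_tensor.abs_eq tensor_of.abs_eq)
  finally show ?thesis by (intro exI[of _ "Poly_Mapping.keys p"] exI[of _ "Poly_Mapping.lookup p"]) simp
qed

lemma clinear_sum: "clinear f \<Longrightarrow> f (sum g A) = (\<Sum>x\<in>A. f (g x))"
  by (rule module_hom.sum[of scaleC scaleC]) (simp add: module_hom_iff_linear)

lemma clinear_eq_on_tensors:
  fixes f g :: "'a::complex_vector \<otimes> 'b::complex_vector \<Rightarrow> 'c::complex_vector"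
  assumes "clinear f" "clinear g" "\<And>x y. f (x \<otimes>\<^sub>t y) = g (x \<otimes>\<^sub>t y)"
  shows "f = g"
proof
  fix t :: "'a \<otimes> 'b"
  obtain K c where t: "t = (\<Sum>(x, y)\<in>K. c (x, y) *\<^sub>C (x \<otimes>\<^sub>t y))"
    using tensor_eq_sum_tensor_of[of t] by blast
  have "f (case k of (x, y) \<Rightarrow> c (x, y) *\<^sub>C (x \<otimes>\<^sub>t y)) =
      g (case k of (x, y) \<Rightarrow> c (x, y) *\<^sub>C (x \<otimes>\<^sub>t y))" for k
    using assms by (auto simp: clinear_iff split: prod.split)
  then show "f t = g t"
    unfolding t by (simp add: clinear_sum assms)
qed

definition free_extend :: "('a \<Rightarrow> 'b \<Rightarrow> 'c::complex_vector) \<Rightarrow> (('a \<times> 'b) \<Rightarrow>\<^sub>0 complex) \<Rightarrow> 'c"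
  where "free_extend b p =
    (\<Sum>k\<in>Poly_Mapping.keys p. Poly_Mapping.lookup p k *\<^sub>C b (fst k) (snd k))"

lemma free_extend_superset:
  assumes "finite K" "Poly_Mapping.keys p \<subseteq> K"
  shows "free_extend b p = (\<Sum>k\<in>K. Poly_Mapping.lookup p k *\<^sub>C b (fst k) (snd k))"
  unfolding free_extend_def
  by (rule sum.mono_neutral_left) (use assms in \<open>auto simp: in_keys_iff\<close>)

lemma clinear_free_extend:
  fixes b :: "'a \<Rightarrow> 'b \<Rightarrow> 'c::complex_vector"
  shows "clinear (free_extend b)"
  unfolding clinear_iff
proof (intro conjI allI)
  fix p q :: "('a \<times> 'b) \<Rightarrow>\<^sub>0 complex"
  let ?K = "Poly_Mapping.keys p \<union> Poly_Mapping.keys q"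
  show "free_extend b (p + q) = free_extend b p + free_extend b q"
    using Poly_Mapping.keys_add[of p q]
    by (simp add: free_extend_superset[of ?K] lookup_add scaleC_add_left sum.distrib)
next
  fix c and p :: "('a \<times> 'b) \<Rightarrow>\<^sub>0 complex"
  have "Poly_Mapping.keys (c *\<^sub>C p) \<subseteq> Poly_Mapping.keys p"
    by (auto simp: in_keys_iff scaleC_poly_mapping.rep_eq)
  then show "free_extend b (c *\<^sub>C p) = c *\<^sub>C free_extend b p"
    by (simp add: free_extend_superset[of "Poly_Mapping.keys p"] scaleC_poly_mapping.rep_eq
        scaleC_complex_def complex_vector.scale_sum_right)
qed

lemma free_extend_free_pair: "free_extend b (free_pair x y) = b x y"
  by (simp add: free_extend_def)

theorem tensor_universal_property:
  assumes "cbilinear b"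
  shows "\<exists>!h. clinear h \<and> (\<forall>x y. h (x \<otimes>\<^sub>t y) = b x y)"
proof -
  note lin = clinear_free_extend[of b, unfolded clinear_iff]
  have diff: "free_extend b (p - q) = free_extend b p - free_extend b q" for p q
  proof -
    have "free_extend b (p - q) + free_extend b q = free_extend b p"
      using lin by (metis diff_add_cancel)
    then show ?thesis by (simp add: eq_diff_eq)
  qed
  have "free_extend b r = 0" if "r \<in> bilinearity_relations" for r
    using that assms lin unfolding bilinearity_relations_def cbilinear_def clinear_iff
    by (auto simp: diff free_extend_free_pair)
  moreover have "complex_vector.subspace {r. free_extend b r = 0}"
    using lin by (auto simp: complex_vector.subspace_def)
      (metis complex_vector.scale_zero_left)
  ultimately have ker: "free_extend b r = 0"
    if "r \<in> complex_vector.span bilinearity_relations" for r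
    using complex_vector.span_minimal[of bilinearity_relations "{r. free_extend b r = 0}"] that
    by auto
  have resp: "free_extend b p = free_extend b q" if "tensor_equiv p q" for p q
    using ker[of "p - q"] that by (simp add: tensor_equiv_def diff)
  define h where "h t = free_extend b (rep_tensor t)" for t
  have h_abs: "h (abs_tensor p) = free_extend b p" for p
    unfolding h_def
    by (rule resp) (simp add: tensor.abs_eq_iff[symmetric] Quotient3_abs_rep[OF Quotient3_tensor])
  have "clinear h"
    unfolding clinear_iff
  proof (intro conjI allI)
    fix s t show "h (s + t) = h s + h t"
      using lin by (induction s rule: tensor.abs_induct, induction t rule: tensor.abs_induct)
        (simp add: plus_tensor.abs_eq h_abs)
  next
    fix c t show "h (c *\<^sub>C t) = c *\<^sub>C h t"
      using lin by (induction t rule: tensor.abs_induct) (simp add: scaleC_tensor.abs_eq h_abs)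
  qed
  moreover have "h (x \<otimes>\<^sub>t y) = b x y" for x y
    by (simp add: tensor_of.abs_eq h_abs free_extend_free_pair)
  ultimately show ?thesis
    by (intro ex1I[of _ h]) (auto intro!: clinear_eq_on_tensors)
qed

text \<open>The tensor product of two linear maps (a junk value if one of them is not linear).\<close>

definition tensor_map ::
    "('a::complex_vector \<Rightarrow> 'c::complex_vector) \<Rightarrow> ('b::complex_vector \<Rightarrow> 'd::complex_vector) \<Rightarrow>
     'a \<otimes> 'b \<Rightarrow> 'c \<otimes> 'd"
  where "tensor_map f g = (THE h. clinear h \<and> (\<forall>x y. h (x \<otimes>\<^sub>t y) = f x \<otimes>\<^sub>t g y))"

lemma
  fixes f :: "'a::complex_vector \<Rightarrow> 'c::complex_vector"
    and g :: "'b::complex_vector \<Rightarrow> 'd::complex_vector"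
  assumes "clinear f" "clinear g"
  shows clinear_tensor_map: "clinear (tensor_map f g)"
    and tensor_map_tensor_of: "tensor_map f g (x \<otimes>\<^sub>t y) = f x \<otimes>\<^sub>t g y"
proof -
  have "cbilinear (\<lambda>x y. f x \<otimes>\<^sub>t g y)"
    using cbilinear_tensor_of[where 'a = 'c and 'b = 'd] assms unfolding cbilinear_def clinear_iff by simp
  from theI'[OF tensor_universal_property[OF this]]
  show "clinear (tensor_map f g)" "tensor_map f g (x \<otimes>\<^sub>t y) = f x \<otimes>\<^sub>t g y"
    unfolding tensor_map_def by auto
qed


section \<open>Coderivations\<close>

definition coderivation ::
    "('c::complex_vector \<Rightarrow> 'c \<otimes> 'c) \<Rightarrow> ('c \<Rightarrow> 'c) \<Rightarrow> bool"
  where "coderivation \<Delta> Y \<longleftrightarrow> clinear Y \<and>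
    \<Delta> \<circ> Y = (\<lambda>x. (tensor_map Y id \<circ> \<Delta>) x + (tensor_map id Y \<circ> \<Delta>) x)"

definition vertical_coderivation ::
    "('c::complex_vector \<Rightarrow> 'c \<otimes> 'c) \<Rightarrow> ('v::complex_vector \<otimes> 'c \<Rightarrow> 'v \<otimes> 'c) \<Rightarrow> bool"
  where "vertical_coderivation \<Delta> T \<longleftrightarrow> (\<exists>Y. coderivation \<Delta> Y \<and> T = tensor_map id Y)"

definition matrix_unit :: "'n \<Rightarrow> 'n \<Rightarrow> complex ^ 'n ^ 'n"
  where "matrix_unit i j = (\<chi> k l. if k = i \<and> l = j then 1 else 0)"

definition matrix_coproduct :: "complex ^ 'n ^ 'n \<Rightarrow> (complex ^ 'n ^ 'n) \<otimes> (complex ^ 'n ^ 'n)"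
  where "matrix_coproduct A =
    (\<Sum>i\<in>UNIV. \<Sum>j\<in>UNIV. (A $ i $ j) *\<^sub>C (matrix_unit i j \<otimes>\<^sub>t matrix_unit i j))"

lemma clinear_matrix_coproduct: "clinear matrix_coproduct"
  unfolding clinear_iff matrix_coproduct_def
  by (simp add: scaleC_add_left sum.distrib complex_vector.scale_sum_right
      scaleC_vec_def scaleC_complex_def)

lemma matrix_coproduct_matrix_unit:
  "matrix_coproduct (matrix_unit i j) = matrix_unit i j \<otimes>\<^sub>t matrix_unit i j"
proof -
  have "matrix_coproduct (matrix_unit i j) =
      (\<Sum>k\<in>UNIV. \<Sum>l\<in>UNIV. if l = j then if k = i
        then matrix_unit i j \<otimes>\<^sub>t matrix_unit i j else 0 else 0)"
    unfolding matrix_coproduct_def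
    by (intro sum.cong refl) (auto simp: matrix_unit_def)
  then show ?thesis by (simp add: sum.delta)
qed


section \<open>Schwartz functions and tempered distributions\<close>

text \<open>
  A list of directions replaces the usual multi-index; repetitions and all orders of
  differentiation are covered. Requiring every iterated partial derivative to be differentiable
  everywhere makes all of them continuous, so \<open>smooth\<close> below is C-infinity.
\<close>

fun iter_partial :: "'n list \<Rightarrow> (real ^ 'n \<Rightarrow> complex) \<Rightarrow> real ^ 'n \<Rightarrow> complex"
  where
    "iter_partial [] f = f"
  | "iter_partial (i # is) f = (\<lambda>x. frechet_derivative (iter_partial is f) (at x) (axis i 1))"

definition smooth :: "(real ^ 'n \<Rightarrow> complex) \<Rightarrow> bool"
  where "smooth f \<longleftrightarrow> (\<forall>is x. iter_partial is f differentiable (at x))"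

definition weighted_partial ::
    "('n \<Rightarrow> nat) \<Rightarrow> 'n list \<Rightarrow> (real ^ 'n \<Rightarrow> complex) \<Rightarrow> real ^ 'n \<Rightarrow> complex"
  where "weighted_partial \<alpha> is f x = of_real (\<Prod>i\<in>UNIV. (x $ i) ^ \<alpha> i) * iter_partial is f x"

definition is_schwartz :: "(real ^ 'n \<Rightarrow> complex) \<Rightarrow> bool"
  where "is_schwartz f \<longleftrightarrow> smooth f \<and> (\<forall>\<alpha> is. bounded (range (weighted_partial \<alpha> is f)))"

lemma iter_partial_zero: "iter_partial is (\<lambda>x. 0) = (\<lambda>x. 0)"
  by (induction "is") simp_all

lemma is_schwartz_zero: "is_schwartz (\<lambda>x. 0)"
  unfolding is_schwartz_def smooth_def weighted_partial_def iter_partial_zero by simp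

lemma smooth_has_derivative:
  "smooth f \<Longrightarrow> (iter_partial is f has_derivative frechet_derivative (iter_partial is f) (at x)) (at x)"
  unfolding smooth_def by (rule frechet_derivative_works[THEN iffD1]) blast

lemma iter_partial_add:
  assumes "smooth f" "smooth g"
  shows "iter_partial is (\<lambda>x. f x + g x) = (\<lambda>x. iter_partial is f x + iter_partial is g x)"
proof (induction "is")
  case (Cons i "is")
  have "frechet_derivative (\<lambda>x. iter_partial is f x + iter_partial is g x) (at x) =
    (\<lambda>v. frechet_derivative (iter_partial is f) (at x) v
       + frechet_derivative (iter_partial is g) (at x) v)" for x
    by (intro frechet_derivative_at[symmetric] has_derivative_add smooth_has_derivative assms)
  then show ?case by (simp add: Cons.IH)
qed simp

lemma iter_partial_mult:
  assumes "smooth f"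
  shows "iter_partial is (\<lambda>x. c * f x) = (\<lambda>x. c * iter_partial is f x)"
proof (induction "is")
  case (Cons i "is")
  have "frechet_derivative (\<lambda>x. c * iter_partial is f x) (at x) =
    (\<lambda>v. c * frechet_derivative (iter_partial is f) (at x) v)" for x
    by (intro frechet_derivative_at[symmetric] has_derivative_mult_right smooth_has_derivative assms)
  then show ?case by (simp add: Cons.IH)
qed simp

lemma is_schwartz_add:
  assumes "is_schwartz f" "is_schwartz g"
  shows "is_schwartz (\<lambda>x. f x + g x)"
proof -
  have sm: "smooth f" "smooth g" using assms by (auto simp: is_schwartz_def)
  have "smooth (\<lambda>x. f x + g x)"
    unfolding smooth_def iter_partial_add[OF sm]
    using sm by (simp add: smooth_def differentiable_add)
  moreover have "bounded (range (weighted_partial \<alpha> is (\<lambda>x. f x + g x)))" for \<alpha> "is"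
  proof -
    have "weighted_partial \<alpha> is (\<lambda>x. f x + g x) =
        (\<lambda>x. weighted_partial \<alpha> is f x + weighted_partial \<alpha> is g x)"
      by (simp add: fun_eq_iff weighted_partial_def iter_partial_add[OF sm] distrib_left)
    then show ?thesis
      using assms bounded_plus_comp[of "weighted_partial \<alpha> is f" UNIV "weighted_partial \<alpha> is g"]
      by (simp add: is_schwartz_def)
  qed
  ultimately show ?thesis by (simp add: is_schwartz_def)
qed

lemma is_schwartz_mult:
  assumes "is_schwartz f"
  shows "is_schwartz (\<lambda>x. c * f x)"
proof -
  have sm: "smooth f" using assms by (auto simp: is_schwartz_def)
  have "smooth (\<lambda>x. c * f x)"
    unfolding smooth_def iter_partial_mult[OF sm]
    using sm by (simp add: smooth_def differentiable_mult)
  moreover have "bounded (range (weighted_partial \<alpha> is (\<lambda>x. c * f x)))" for \<alpha> "is"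
  proof -
    have "weighted_partial \<alpha> is (\<lambda>x. c * f x) = (\<lambda>x. c * weighted_partial \<alpha> is f x)"
      by (simp add: fun_eq_iff weighted_partial_def iter_partial_mult[OF sm])
    moreover have "bounded ((\<lambda>z. c * z) ` range (weighted_partial \<alpha> is f))"
      using assms bounded_linear_image[OF _ bounded_linear_mult_right] unfolding is_schwartz_def by blast
    ultimately show ?thesis by (simp add: image_image)
  qed
  ultimately show ?thesis by (simp add: is_schwartz_def)
qed

typedef 'n schwartz = "{f :: real ^ 'n::finite \<Rightarrow> complex. is_schwartz f}"
  morphisms schwartz_fun Abs_schwartz
  using is_schwartz_zero by blast

setup_lifting type_definition_schwartz

instantiation schwartz :: (finite) complex_vector
begin

lift_definition zero_schwartz :: "'a schwartz" is "\<lambda>x. 0"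
  by (rule is_schwartz_zero)

lift_definition plus_schwartz :: "'a schwartz \<Rightarrow> 'a schwartz \<Rightarrow> 'a schwartz"
  is "\<lambda>f g x. f x + g x"
  by (rule is_schwartz_add)

lift_definition uminus_schwartz :: "'a schwartz \<Rightarrow> 'a schwartz" is "\<lambda>f x. - f x"
  using is_schwartz_mult[of _ "-1"] by simp

lift_definition minus_schwartz :: "'a schwartz \<Rightarrow> 'a schwartz \<Rightarrow> 'a schwartz"
  is "\<lambda>f g x. f x - g x"
  using is_schwartz_add is_schwartz_mult[of _ "-1"] by fastforce

lift_definition scaleC_schwartz :: "complex \<Rightarrow> 'a schwartz \<Rightarrow> 'a schwartz"
  is "\<lambda>c f x. c * f x"
  by (rule is_schwartz_mult)

instance
  by standard (transfer; simp add: fun_eq_iff algebra_simps)+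

end

definition schwartz_seminorm :: "('n::finite \<Rightarrow> nat) \<Rightarrow> 'n list \<Rightarrow> 'n schwartz \<Rightarrow> real"
  where "schwartz_seminorm \<alpha> is f = (SUP x. norm (weighted_partial \<alpha> is (schwartz_fun f) x))"

definition schwartz_topology :: "'n::finite schwartz topology"
  where "schwartz_topology =
    topology_generated_by {{g. schwartz_seminorm \<alpha> is (g - f) < e} | \<alpha> is f e. e > 0}"

lemma schwartz_seminorm_zero: "schwartz_seminorm \<alpha> is 0 = 0"
  by (simp add: schwartz_seminorm_def weighted_partial_def zero_schwartz.rep_eq iter_partial_zero)

lemma topspace_schwartz_topology: "topspace (schwartz_topology :: 'n::finite schwartz topology) = UNIV"
proof -
  have "f \<in> \<Union>{{g. schwartz_seminorm \<alpha> is (g - f) < e} | \<alpha> is f e. e > 0}" for f :: "'n schwartz"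
  proof (rule UnionI)
    show "{g. schwartz_seminorm (\<lambda>_. 0) [] (g - f) < 1} \<in>
        {{g. schwartz_seminorm \<alpha> is (g - f) < e} | \<alpha> is f e. e > 0}"
      by (rule CollectI, intro exI conjI, rule refl, rule zero_less_one)
  qed (simp add: schwartz_seminorm_zero)
  then show ?thesis
    unfolding schwartz_topology_def topology_generated_by_topspace by blast
qed

lemma continuous_map_complex_add:
  fixes u v :: "'a \<Rightarrow> complex"
  assumes "continuous_map X euclidean u" "continuous_map X euclidean v"
  shows "continuous_map X euclidean (\<lambda>x. u x + v x)"
  using assms unfolding continuous_map_atin limitin_canonical_iff by (blast intro: tendsto_add)

lemma continuous_map_complex_mult_left:
  fixes u :: "'a \<Rightarrow> complex"
  assumes "continuous_map X euclidean u"
  shows "continuous_map X euclidean (\<lambda>x. c * u x)"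
  using assms unfolding continuous_map_atin limitin_canonical_iff by (blast intro: tendsto_mult_left)

lemma tempered_add:
  fixes u v :: "'n::finite schwartz \<Rightarrow> complex"
  assumes "clinear u \<and> continuous_map schwartz_topology euclidean u"
    and "clinear v \<and> continuous_map schwartz_topology euclidean v"
  shows "clinear (\<lambda>f. u f + v f) \<and> continuous_map schwartz_topology euclidean (\<lambda>f. u f + v f)"
  using assms continuous_map_complex_add[of schwartz_topology u v]
  by (simp add: clinear_iff scaleC_add_right)

lemma tempered_mult:
  fixes u :: "'n::finite schwartz \<Rightarrow> complex"
  assumes "clinear u \<and> continuous_map schwartz_topology euclidean u"
  shows "clinear (\<lambda>f. c * u f) \<and> continuous_map schwartz_topology euclidean (\<lambda>f. c * u f)"
  using assms continuous_map_complex_mult_left[of schwartz_topology u c]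
  by (simp add: clinear_iff scaleC_complex_def distrib_left mult.left_commute)

typedef 'n tempered_distribution =
  "{u :: 'n::finite schwartz \<Rightarrow> complex. clinear u \<and> continuous_map schwartz_topology euclidean u}"
  morphisms distribution_fun Abs_tempered_distribution
  by (rule exI[of _ "\<lambda>_. 0"]) (simp add: clinear_iff)

setup_lifting type_definition_tempered_distribution

instantiation tempered_distribution :: (finite) complex_vector
begin

lift_definition zero_tempered_distribution :: "'a tempered_distribution" is "\<lambda>f. 0"
  by (simp add: clinear_iff)

lift_definition plus_tempered_distribution ::
    "'a tempered_distribution \<Rightarrow> 'a tempered_distribution \<Rightarrow> 'a tempered_distribution"
  is "\<lambda>u v f. u f + v f"
  by (rule tempered_add)

lift_definition uminus_tempered_distribution ::
    "'a tempered_distribution \<Rightarrow> 'a tempered_distribution"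
  is "\<lambda>u f. - u f"
  by (drule tempered_mult[of _ "-1"]) simp

lift_definition minus_tempered_distribution ::
    "'a tempered_distribution \<Rightarrow> 'a tempered_distribution \<Rightarrow> 'a tempered_distribution"
  is "\<lambda>u v f. u f - v f"
proof -
  fix u v :: "'a schwartz \<Rightarrow> complex"
  assume u: "clinear u \<and> continuous_map schwartz_topology euclidean u"
    and v: "clinear v \<and> continuous_map schwartz_topology euclidean v"
  from tempered_add[OF u tempered_mult[OF v, of "-1"]]
  show "clinear (\<lambda>f. u f - v f) \<and> continuous_map schwartz_topology euclidean (\<lambda>f. u f - v f)"
    by simp
qed

lift_definition scaleC_tempered_distribution ::
    "complex \<Rightarrow> 'a tempered_distribution \<Rightarrow> 'a tempered_distribution"
  is "\<lambda>c u f. c * u f"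
  by (rule tempered_mult)

instance
  by standard (transfer, simp add: fun_eq_iff algebra_simps)+

end

end

(* Comparing the coefficients of E_kl (x) E_ij on both sides of the co-Leibniz rule at the grouplike
   element E_ij gives 0 = y_kl for (k,l) different from (i,j), and y_ij = 2 y_ij otherwise, where
   y = Y E_ij; hence Y vanishes on the matrix units. *)
theory Submission
  imports Defs
begin

lemma matrix_unit_component: "matrix_unit i j $ k $ l = (if k = i \<and> l = j then 1 else 0)"
  by (simp add: matrix_unit_def)

lemma matrix_eq_sum_matrix_unit:
  "A = (\<Sum>i\<in>UNIV. \<Sum>j\<in>UNIV. (A $ i $ j) *\<^sub>C matrix_unit i j)"
proof -
  have "(\<Sum>i\<in>UNIV. \<Sum>j\<in>UNIV. (A $ i $ j) *\<^sub>C matrix_unit i j) $ k $ l =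
      (\<Sum>i\<in>UNIV. \<Sum>j\<in>UNIV. if j = l then if i = k then A $ k $ l else 0 else 0)" for k l
    by (simp only: sum_component, intro sum.cong refl)
      (auto simp: matrix_unit_component scaleC_vec_def scaleC_complex_def)
  then show ?thesis by (simp add: vec_eq_iff)
qed

text \<open>The product of two matrix entries is bilinear, so the universal property turns it into a
  linear functional on the tensor square. It reads off the coefficient of
  \<open>matrix_unit k l \<otimes>\<^sub>t matrix_unit p q\<close>, so tensors can be compared
  without first proving that these products form a basis.\<close>

lemma matrix_tensor_coefficient:
  obtains h :: "(complex ^ 'n ^ 'n) \<otimes> (complex ^ 'n ^ 'n) \<Rightarrow> complex"
  where "clinear h" "\<And>A B. h (A \<otimes>\<^sub>t B) = A $ k $ l * B $ p $ q"
proof -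
  have "cbilinear (\<lambda>A B :: complex ^ 'n ^ 'n. A $ k $ l * B $ p $ q)"
    by (simp add: cbilinear_def clinear_iff scaleC_vec_def scaleC_complex_def algebra_simps)
  from tensor_universal_property[OF this] that show thesis by blast
qed

lemma clinear_id: "clinear id"
  by (simp add: clinear_iff)

text \<open>Carries the vanishing of a coderivation over to the vertical operator built from it.
  Linear maps on a tensor product are determined by their values on pure tensors.\<close>

lemma tensor_map_id_zero: "tensor_map id (\<lambda>_. 0) = (\<lambda>_. 0)"
proof (rule clinear_eq_on_tensors)
  have zero: "clinear (\<lambda>_. 0)"
    by (simp add: clinear_iff)
  show "clinear (tensor_map id (\<lambda>_. 0))"
    by (rule clinear_tensor_map[OF clinear_id zero])
  show "clinear (\<lambda>_. 0)"
    by (rule zero)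
  fix x y
  \<comment> \<open>Moving the scalar 0 out of the second factor shows that a pure tensor with zero
    second factor vanishes.\<close>
  have "x \<otimes>\<^sub>t (0 *\<^sub>C 0) = 0 *\<^sub>C (x \<otimes>\<^sub>t 0)"
    using cbilinear_tensor_of unfolding cbilinear_def clinear_iff by blast
  then show "tensor_map id (\<lambda>_. 0) (x \<otimes>\<^sub>t y) = 0"
    by (simp add: tensor_map_tensor_of[OF clinear_id zero])
qed

lemma coderivation_matrix_coproduct_matrix_unit:
  fixes Y :: "complex ^ 'n ^ 'n \<Rightarrow> complex ^ 'n ^ 'n"
  assumes "coderivation matrix_coproduct Y"
  shows "Y (matrix_unit i j) = 0"
proof -
  let ?E = "matrix_unit i j"
  have lin: "clinear Y"
    using assms by (simp add: coderivation_def)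
  have leibniz: "matrix_coproduct (Y ?E) = Y ?E \<otimes>\<^sub>t ?E + ?E \<otimes>\<^sub>t Y ?E"
    using assms unfolding coderivation_def
    by (auto dest!: fun_cong[where x = ?E]
        simp: matrix_coproduct_matrix_unit tensor_map_tensor_of lin clinear_id)
  have "Y ?E $ k $ l = 0" for k l
  proof -
    \<comment> \<open>The second factor is tested at the entry (i, j), where \<open>?E\<close> has
      entry 1, so the term \<open>Y ?E \<otimes>\<^sub>t ?E\<close> contributes exactly the entry of
      \<open>Y ?E\<close> at (k, l).\<close>
    obtain h :: "(complex ^ 'n ^ 'n) \<otimes> (complex ^ 'n ^ 'n) \<Rightarrow> complex"
      where h: "clinear h" "\<And>A B. h (A \<otimes>\<^sub>t B) = A $ k $ l * B $ i $ j"
      using matrix_tensor_coefficient[of k l i j] by blast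
    \<comment> \<open>The coproduct contains only the diagonal terms
      \<open>matrix_unit p q \<otimes>\<^sub>t matrix_unit p q\<close>. The second factor forces (p,
      q) = (i, j), and the first then forces (k, l) = (i, j). The nested conditionals let each sum
      collapse as a Kronecker delta.\<close>
    have "h (matrix_coproduct (Y ?E)) =
        (\<Sum>p\<in>UNIV. \<Sum>q\<in>UNIV.
          if q = j then if p = i then if k = i \<and> l = j then Y ?E $ k $ l else 0 else 0 else 0)"
      unfolding matrix_coproduct_def clinear_sum[OF h(1)]
      using h by (intro sum.cong refl) (auto simp: clinear_iff scaleC_complex_def matrix_unit_component)
    also have "\<dots> = (if k = i \<and> l = j then Y ?E $ k $ l else 0)"
      by simp
    finally have "(if k = i \<and> l = j then Y ?E $ k $ l else 0) =
        Y ?E $ k $ l + (if k = i \<and> l = j then 1 else 0) * Y ?E $ i $ j"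
      using h unfolding leibniz by (simp add: clinear_iff matrix_unit_component)
    then show ?thesis
      by (auto split: if_splits)
  qed
  then show ?thesis
    by (simp add: vec_eq_iff)
qed

text \<open>The matrix units span the matrix space, so vanishing on them suffices by
  linearity.\<close>

lemma coderivation_matrix_coproduct_eq_zero:
  assumes "coderivation matrix_coproduct Y"
  shows "Y = (\<lambda>_. 0)"
proof
  fix A
  have lin: "clinear Y"
    using assms by (simp add: coderivation_def)
  have "Y A = Y (\<Sum>i\<in>UNIV. \<Sum>j\<in>UNIV. (A $ i $ j) *\<^sub>C matrix_unit i j)"
    by (subst matrix_eq_sum_matrix_unit[of A]) (rule refl)
  also have "\<dots> = (\<Sum>i\<in>UNIV. \<Sum>j\<in>UNIV. (A $ i $ j) *\<^sub>C Y (matrix_unit i j))"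
    using lin unfolding clinear_sum[OF lin] by (simp add: clinear_iff)
  also have "\<dots> = 0"
    by (simp add: coderivation_matrix_coproduct_matrix_unit[OF assms])
  finally show "Y A = 0" .
qed

theorem mainTheorem2:
  shows "(\<nexists>Y :: complex ^ 'n ^ 'n \<Rightarrow> complex ^ 'n ^ 'n.
            coderivation matrix_coproduct Y \<and> Y \<noteq> (\<lambda>_. 0)) \<and>
         (\<nexists>T :: 'n tempered_distribution \<otimes> (complex ^ 'n ^ 'n) \<Rightarrow>
                 'n tempered_distribution \<otimes> (complex ^ 'n ^ 'n).
            vertical_coderivation matrix_coproduct T \<and> T \<noteq> (\<lambda>_. 0))"
  unfolding vertical_coderivation_def
  using coderivation_matrix_coproduct_eq_zero tensor_map_id_zero by blast

end
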